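(* Let $k$ be an algebraically closed field of characteristic zero, $n\ge1$, $B=k[x_1,\dots,x_n]$, $D$ a locally nilpotent $k$-derivation of $B$ with slice $s$ (i.e. $D(s)=1$), $N\in\mathbb{Z}\setminus\{0\}$, and $\alpha$ the $\mathbb{G}_{\mathrm m}$-action on $\mathbb{A}^n=\operatorname{Spec}(B)$ associated with $\partial=NsD$. Then $\alpha$ is linearizable if and only if there exists $\phi\in\operatorname{Aut}_k(B)$ such that $$\phi(\ker D)=k[x_1,\dots,x_{n-1}]\quad\text{and}\quad\phi(s)\in x_n+k[x_1,\dots,x_{n-1}].$$
   Context: A $k$-derivation $D$ of $B$ is locally nilpotent if for every $b\in B$ there is $m\ge1$ with $D^m(b)=0$. With $A=\ker D$, $B=A[s]$ is a polynomial ring in $s$ over $A$ (Slice Theorem), and the action $\alpha$ associated with $\partial=NsD$ is $\alpha_t(P(s))=P(t^Ns)$ for $P\in A[T]$, $t\in k^*$. The action $\alpha$ is called linearizable if there exists $\phi\in\operatorname{Aut}_k(B)$ such that $\phi\partial\phi^{-1}$ is a diagonal linear derivation $\sum_i\lambda_ix_i\frac{\partial}{\partial x_i}$, $\lambda_i\in k$. *)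

theory Defs
  imports
    "HOL-Library.Poly_Mapping"
    "HOL-Computational_Algebra.Computational_Algebra"
begin

text \<open>
  The polynomial ring over \<^typ>\<open>'k\<close> in the variables indexed by a finite linearly ordered type
  \<^typ>\<open>'n\<close>: finitely supported functions from exponent vectors to coefficients, with the
  convolution product. For \<open>n = CARD('n)\<close> this is \<open>k[x\<^sub>1, \<dots>, x\<^sub>n]\<close>, the variables being listed in
  the order of \<^typ>\<open>'n\<close>.
\<close>

type_synonym ('n, 'k) mpoly = "('n \<Rightarrow>\<^sub>0 nat) \<Rightarrow>\<^sub>0 'k"

definition const :: "'k \<Rightarrow> ('n, 'k::field) mpoly" where
  "const c = Poly_Mapping.single 0 c"

definition var :: "'n \<Rightarrow> ('n, 'k::field) mpoly" where
  "var i = Poly_Mapping.single (Poly_Mapping.single i 1) 1"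

text \<open>The subring \<open>k[x\<^sub>i : i \<in> V]\<close>.\<close>

definition polys_in :: "'n set \<Rightarrow> ('n, 'k::field) mpoly set" where
  "polys_in V = {p. \<forall>m \<in> Poly_Mapping.keys p. Poly_Mapping.keys m \<subseteq> V}"

definition last_index :: "'n::{finite,linorder}" where
  "last_index = Max UNIV"

definition partial_deriv :: "'n \<Rightarrow> ('n, 'k::field) mpoly \<Rightarrow> ('n, 'k) mpoly" where
  "partial_deriv i p =
     (\<Sum>m \<in> Poly_Mapping.keys p.
        Poly_Mapping.single (m - Poly_Mapping.single i 1)
          (of_nat (Poly_Mapping.lookup m i) * Poly_Mapping.lookup p m))"

definition k_derivation :: "(('n, 'k::field) mpoly \<Rightarrow> ('n, 'k) mpoly) \<Rightarrow> bool" where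
  "k_derivation D \<longleftrightarrow>
     (\<forall>p q. D (p + q) = D p + D q) \<and>
     (\<forall>c p. D (const c * p) = const c * D p) \<and>
     (\<forall>p q. D (p * q) = D p * q + p * D q)"

definition locally_nilpotent :: "(('n, 'k::field) mpoly \<Rightarrow> ('n, 'k) mpoly) \<Rightarrow> bool" where
  "locally_nilpotent D \<longleftrightarrow> (\<forall>b. \<exists>m\<ge>1. (D ^^ m) b = 0)"

definition der_ker :: "(('n, 'k::field) mpoly \<Rightarrow> ('n, 'k) mpoly) \<Rightarrow> ('n, 'k) mpoly set" where
  "der_ker D = {b. D b = 0}"

definition k_automorphism :: "(('n, 'k::field) mpoly \<Rightarrow> ('n, 'k) mpoly) \<Rightarrow> bool" where
  "k_automorphism \<phi> \<longleftrightarrow>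
     bij \<phi> \<and>
     (\<forall>p q. \<phi> (p + q) = \<phi> p + \<phi> q) \<and>
     (\<forall>p q. \<phi> (p * q) = \<phi> p * \<phi> q) \<and>
     (\<forall>c. \<phi> (const c) = const c)"

definition diagonal_derivation ::
  "('n::finite \<Rightarrow> 'k::field) \<Rightarrow> ('n, 'k) mpoly \<Rightarrow> ('n, 'k) mpoly" where
  "diagonal_derivation l p = (\<Sum>i\<in>UNIV. const (l i) * var i * partial_deriv i p)"

text \<open>
  The action on \<open>B = A[s]\<close>, \<open>A = ker D\<close>, given by \<open>\<alpha>\<^sub>t(P(s)) = P(t\<^sup>N s)\<close> for \<open>P \<in> A[T]\<close> and \<open>t \<noteq> 0\<close>.
  The polynomial \<open>P\<close> is an element of \<open>B[T]\<close> with all coefficients in \<open>A\<close>; the Slice Theorem says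
  that every \<open>b\<close> equals \<open>P(s)\<close> for exactly one such \<open>P\<close>.
\<close>

definition slice_action ::
  "(('n::{finite,linorder}, 'k::field) mpoly \<Rightarrow> ('n, 'k) mpoly) \<Rightarrow> ('n, 'k) mpoly \<Rightarrow> int \<Rightarrow>
     'k \<Rightarrow> ('n, 'k) mpoly \<Rightarrow> ('n, 'k) mpoly" where
  "slice_action D s N t b =
     (let P = (THE P. set (coeffs P) \<subseteq> der_ker D \<and> poly P s = b)
      in poly P (const (t powi N) * s))"

text \<open>
  The derivation associated with a \<open>\<G>\<^sub>m\<close>-action \<open>\<alpha>\<close> on \<open>Spec B\<close>: if \<open>\<alpha>\<^sub>t(b) = \<Sum>\<^sub>m t\<^sup>m b\<^sub>m\<close> (a finite
  sum over integers \<open>m\<close>), then \<open>\<partial> b = \<Sum>\<^sub>m m b\<^sub>m\<close>, the \<open>t\<close>-derivative of \<open>\<alpha>\<^sub>t(b)\<close> at \<open>t = 1\<close>. Over an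
  infinite field the \<open>b\<^sub>m\<close>, and hence \<open>\<partial>\<close>, are determined by \<open>\<alpha>\<close>.
\<close>

definition associated_derivation ::
  "('k \<Rightarrow> ('n, 'k::field) mpoly \<Rightarrow> ('n, 'k) mpoly) \<Rightarrow>
     (('n, 'k) mpoly \<Rightarrow> ('n, 'k) mpoly) \<Rightarrow> bool" where
  "associated_derivation \<alpha> \<Delta> \<longleftrightarrow>
     k_derivation \<Delta> \<and>
     (\<forall>b. \<exists>M c. finite M \<and>
        (\<forall>t. t \<noteq> 0 \<longrightarrow> \<alpha> t b = (\<Sum>m\<in>M. const (t powi m) * c m)) \<and>
        \<Delta> b = (\<Sum>m\<in>M. of_int m * c m))"

definition linearizable ::
  "('k \<Rightarrow> ('n::finite, 'k::field) mpoly \<Rightarrow> ('n, 'k) mpoly) \<Rightarrow> bool" where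
  "linearizable \<alpha> \<longleftrightarrow>
     (\<exists>\<Delta>. associated_derivation \<alpha> \<Delta> \<and>
       (\<exists>\<phi> l. k_automorphism \<phi> \<and> \<phi> \<circ> \<Delta> \<circ> inv \<phi> = diagonal_derivation l))"

end

theory Submission
  imports Defs
begin

text \<open>
  By the slice theorem every \<open>b\<close> is \<open>P(s)\<close> for a unique polynomial \<open>P\<close> over \<open>A = ker D\<close>
  (\<open>slice_expansion_exists\<close>, \<open>slice_expansion_unique\<close>). On the summand \<open>A s\<^sup>j\<close> the action multiplies by
  \<open>t\<close> to the power \<open>N j\<close>, so the only derivation associated with it is \<open>\<partial> = N s D\<close>
  (\<open>associated_derivation_slice_action_iff\<close>). The question is therefore when \<open>N s D\<close> is conjugate to a
  diagonal derivation.
  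
  Suppose that \<open>\<phi> \<partial> \<phi>\<^sup>-\<^sup>1\<close> is diagonal with entries \<open>\<lambda>\<^sub>i\<close>, and put \<open>\<sigma> = \<phi>(s)\<close> and \<open>E = \<phi> D \<phi>\<^sup>-\<^sup>1\<close>, so that
  \<open>E \<sigma> = 1\<close> and \<open>N \<sigma> E(x\<^sub>i) = \<lambda>\<^sub>i x\<^sub>i\<close> for all \<open>i\<close>. Not all \<open>\<lambda>\<^sub>i\<close> vanish, as \<open>E \<noteq> 0\<close>; hence \<open>\<sigma>\<close> divides
  some variable \<open>x\<^sub>j\<close>. A divisor of a variable is a constant or a constant multiple of it, and \<open>\<sigma>\<close> is not
  constant because \<open>E \<sigma> = 1\<close>; so \<open>\<sigma> = c x\<^sub>j\<close>. For \<open>i \<noteq> j\<close> the variable \<open>x\<^sub>j\<close> divides \<open>\<lambda>\<^sub>i x\<^sub>i\<close>, which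
  forces \<open>\<lambda>\<^sub>i = 0\<close> and \<open>E(x\<^sub>i) = 0\<close>. Thus \<open>E\<close> is a nonzero scalar multiple of the partial derivative with
  respect to \<open>x\<^sub>j\<close>, and its kernel \<open>\<phi>(A)\<close> is the polynomial ring in the other variables
  (\<open>slice_eq_scaled_variable\<close>, \<open>der_ker_eq_polys_in\<close>). It remains to exchange \<open>x\<^sub>j\<close> with \<open>x\<^sub>n\<close> and to
  remove the factor \<open>c\<close>.
  
  Conversely, if \<open>\<phi>(A) = k[x\<^sub>1, \<dots>, x\<^sub>n\<^sub>-\<^sub>1]\<close> and \<open>\<phi>(s) = x\<^sub>n + f\<close>, the triangular automorphism sending \<open>x\<^sub>n\<close>
  to \<open>x\<^sub>n - f\<close> fixes \<open>\<phi>(A)\<close> and moves \<open>\<phi>(s)\<close> to \<open>x\<^sub>n\<close>. In the new coordinates \<open>D\<close> is the partial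
  derivative with respect to \<open>x\<^sub>n\<close>, and \<open>N s D\<close> is diagonal with the single entry \<open>N\<close>.
\<close>

section \<open>Constants, monomials and divisors of a variable\<close>

lemma const_0 [simp]: "const 0 = 0"
  and const_1 [simp]: "const 1 = 1"
  and const_add: "const (a + b) = const a + const b"
  and const_mult: "const (a * b) = const a * const b"
  by (simp_all add: const_def single_add mult_single)

lemma const_eq_0_iff [simp]: "const a = 0 \<longleftrightarrow> a = 0"
  by (metis const_0 const_def lookup_single_eq)

lemma const_cancel:
  assumes "a \<noteq> 0"
  shows "const a * (const (inverse a) * p) = p" "const (inverse a) * (const a * p) = p"
  using assms by (simp_all add: mult.assoc [symmetric] flip: const_mult)

lemma const_power: "const (a ^ n) = const a ^ n"
  by (induction n) (simp_all add: const_mult)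

lemma const_of_nat: "const (of_nat n) = of_nat n"
  by (simp add: const_def)

lemma const_of_int: "const (of_int n) = of_int n"
  by (simp add: const_def)

lemma lookup_const_mult: "Poly_Mapping.lookup (const a * p) m = a * Poly_Mapping.lookup p m"
  by (simp add: const_def flip: mult_map_scale_conv_mult) (simp add: map.rep_eq when_def)

lemma var_neq_0 [simp]: "var i \<noteq> 0"
  by (metis lookup_single_eq lookup_zero var_def zero_neq_one)

lemma keys_const_mult_var: "a \<noteq> 0 \<Longrightarrow> Poly_Mapping.keys (const a * var i) = {Poly_Mapping.single i 1}"
  by (simp add: const_def var_def mult_single)

lemma sum_monomials: "p = (\<Sum>m\<in>Poly_Mapping.keys p. Poly_Mapping.single m (Poly_Mapping.lookup p m))"
  by (rule poly_mapping_eqI) (simp add: lookup_sum lookup_single when_def in_keys_iff)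

lemma mpoly_additive_induct [case_names zero add single]:
  assumes "P 0" "\<And>p q. P p \<Longrightarrow> P q \<Longrightarrow> P (p + q)" "\<And>m c. P (Poly_Mapping.single m c)"
  shows "P (p :: ('n, 'k::field) mpoly)"
proof -
  have "P (\<Sum>m\<in>M. Poly_Mapping.single m (Poly_Mapping.lookup p m))" if "finite M" for M
    using that by induction (use assms in auto)
  then show ?thesis
    using sum_monomials[of p] finite_keys by metis
qed

text \<open>
  The monomial in the third case lets a statement about products with a variable be checked on
  monomials, where the partial derivatives have a closed form.
\<close>

lemma mpoly_induct [case_names const add var_mult]:
  assumes const: "\<And>c. P (const c)"
    and add: "\<And>p q. P p \<Longrightarrow> P q \<Longrightarrow> P (p + q)"
    and var_mult: "\<And>i m c. P (Poly_Mapping.single m c) \<Longrightarrow> P (var i * Poly_Mapping.single m c)"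
  shows "P (p :: ('n, 'k::field) mpoly)"
proof (induction p rule: mpoly_additive_induct)
  case zero
  show ?case using const[of 0] by simp
next
  case (single m c)
  show ?case
  proof (induction m rule: update_induct)
    case const
    show ?case using assms(1)[of c] by (simp add: const_def)
  next
    case (update f i v)
    have "P (Poly_Mapping.single (Poly_Mapping.single i n + f) c)" for n
    proof (induction n)
      case 0
      then show ?case using update by simp
    next
      case (Suc n)
      have "var i * Poly_Mapping.single (Poly_Mapping.single i n + f) c
          = Poly_Mapping.single (Poly_Mapping.single i (Suc n) + f) c"
        by (simp add: var_def mult_single add.assoc [symmetric] single_add [symmetric])
      then show ?case using var_mult[OF Suc, of i] by (simp only:)
    qed
    moreover have "Poly_Mapping.single i v + f = Poly_Mapping.update i v f"
      using update.hyps
      by (intro poly_mapping_eqI) (auto simp: lookup_add lookup_single lookup_update in_keys_iff)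
    ultimately show ?case by metis
  qed
qed (use add in auto)

text \<open>
  The leading exponents add: among all pairs of exponents of \<open>p\<close> and \<open>q\<close>, only the pair of the two
  largest ones can have the sum \<open>a + b\<close>, so no cancellation occurs there.
\<close>

lemma lookup_mult_Max:
  fixes p q :: "'m::{ordered_cancel_comm_monoid_add,linorder} \<Rightarrow>\<^sub>0 'k::semiring_0"
  assumes "p \<noteq> 0" "q \<noteq> 0"
  defines "a \<equiv> Max (Poly_Mapping.keys p)" and "b \<equiv> Max (Poly_Mapping.keys q)"
  shows "Poly_Mapping.lookup (p * q) (a + b) = Poly_Mapping.lookup p a * Poly_Mapping.lookup q b"
proof -
  have "Poly_Mapping.lookup p l * (\<Sum>r. Poly_Mapping.lookup q r when a + b = l + r) = (Poly_Mapping.lookup p a * Poly_Mapping.lookup q b when l = a)" for l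
  proof (cases "Poly_Mapping.lookup p l = 0")
    case True
    then show ?thesis by (auto simp: when_def)
  next
    case False
    then have "l \<le> a" by (simp add: a_def in_keys_iff)
    have *: "(Poly_Mapping.lookup q r when a + b = l + r) = (Poly_Mapping.lookup q b when l = a when r = b)" for r
    proof (cases "Poly_Mapping.lookup q r = 0")
      case True
      then show ?thesis by (auto simp: when_def)
    next
      case False
      then have "r \<le> b" by (simp add: b_def in_keys_iff)
      then have "a + b = l + r \<longleftrightarrow> l = a \<and> r = b"
        using \<open>l \<le> a\<close> by (metis add_less_le_mono add_left_cancel order.strict_iff_order)
      then show ?thesis by (auto simp: when_def)
    qed
    show ?thesis
      unfolding * by (auto simp: when_def)
  qed
  then show ?thesis
    by (simp add: lookup_mult)
qed

lemma exponent_nonneg: "0 \<le> (m :: 'n::linorder \<Rightarrow>\<^sub>0 nat)"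
proof -
  have "\<not> m < 0"
    by transfer (simp add: less_fun_def)
  then show ?thesis by simp
qed

text \<open>
  For the lexicographic order the zero exponent is the least one, so a polynomial with leading exponent
  zero has no other monomial.
\<close>

lemma const_of_Max_keys_0:
  fixes p :: "('n::linorder, 'k::field) mpoly"
  assumes "Max (Poly_Mapping.keys p) = 0"
  shows "p = const (Poly_Mapping.lookup p 0)"
proof (rule poly_mapping_eqI)
  fix m
  have "m = 0" if "m \<in> Poly_Mapping.keys p"
    using that assms exponent_nonneg[of m] Max_ge[OF finite_keys that] by simp
  then show "Poly_Mapping.lookup p m = Poly_Mapping.lookup (const (Poly_Mapping.lookup p 0)) m"
    by (auto simp: const_def lookup_single when_def in_keys_iff)
qed

text \<open>
  The leading exponents of \<open>p\<close> and \<open>q\<close> add up to a unit vector, so one of them is zero.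
\<close>

lemma divisors_of_var:
  fixes p q :: "('n::linorder, 'k::field) mpoly"
  assumes pq: "p * q = const a * var i" and "a \<noteq> 0"
  obtains c where "p = const c" | d where "q = const d"
proof -
  define m where "m = Max (Poly_Mapping.keys p)"
  define r where "r = Max (Poly_Mapping.keys q)"
  have nz: "p \<noteq> 0" "q \<noteq> 0" using assms by auto
  then have "m \<in> Poly_Mapping.keys p" "r \<in> Poly_Mapping.keys q"
    by (simp_all add: m_def r_def)
  then have "Poly_Mapping.lookup (p * q) (m + r) \<noteq> 0"
    using lookup_mult_Max[OF nz] by (simp add: m_def r_def in_keys_iff)
  then have "m + r \<in> Poly_Mapping.keys (const a * var i)"
    unfolding pq in_keys_iff .
  then have mr: "m + r = Poly_Mapping.single i 1"
    unfolding keys_const_mult_var[OF \<open>a \<noteq> 0\<close>] by simp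
  have lk: "Poly_Mapping.lookup m j + Poly_Mapping.lookup r j = (if j = i then 1 else 0)" for j
    using lookup_add[of m r j] by (auto simp: mr lookup_single when_def split: if_splits)
  have "m = 0 \<or> r = 0"
  proof (cases "Poly_Mapping.lookup m i = 0")
    case True
    then have "Poly_Mapping.lookup m j = 0" for j using lk[of j] by (auto split: if_splits)
    then show ?thesis by (simp add: poly_mapping_eqI)
  next
    case False
    then have "Poly_Mapping.lookup r j = 0" for j using lk[of j] by (auto split: if_splits)
    then show ?thesis by (simp add: poly_mapping_eqI)
  qed
  then show ?thesis
    using const_of_Max_keys_0 that unfolding m_def r_def by metis
qed

section \<open>Derivations\<close>

lemma k_derivation_add: "k_derivation D \<Longrightarrow> D (p + q) = D p + D q"
  and k_derivation_mult: "k_derivation D \<Longrightarrow> D (p * q) = D p * q + p * D q"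
  and k_derivation_const_mult: "k_derivation D \<Longrightarrow> D (const c * p) = const c * D p"
  unfolding k_derivation_def by blast+

lemma k_derivation_zero:
  assumes "k_derivation D"
  shows "D 0 = 0"
  using k_derivation_add[OF assms, of 0 0] by simp

lemma k_derivation_const:
  assumes "k_derivation D"
  shows "D (const c) = 0"
  using k_derivation_mult[OF assms, of 1 1] k_derivation_const_mult[OF assms, of c 1] by simp

lemma k_derivation_diff:
  assumes "k_derivation D"
  shows "D (p - q) = D p - D q"
  using k_derivation_add[OF assms, of "p - q" q] by simp

lemma k_derivation_sum:
  assumes "k_derivation D"
  shows "D (sum f I) = (\<Sum>i\<in>I. D (f i))"
  by (induction I rule: infinite_finite_induct)
    (simp_all add: k_derivation_zero[OF assms] k_derivation_add[OF assms])

lemma k_derivation_scale: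
  assumes "k_derivation D"
  shows "k_derivation (\<lambda>p. g * D p)"
  unfolding k_derivation_def
proof (intro conjI allI)
  show "g * D (p + q) = g * D p + g * D q" for p q
    by (simp add: k_derivation_add[OF assms] distrib_left)
  show "g * D (const c * p) = const c * (g * D p)" for c p
    by (simp only: k_derivation_const_mult[OF assms] mult.left_commute)
  show "g * D (p * q) = g * D p * q + p * (g * D q)" for p q
    by (simp only: k_derivation_mult[OF assms] distrib_left mult_ac)
qed

lemma partial_deriv_superset:
  assumes "finite M" "Poly_Mapping.keys p \<subseteq> M"
  shows "partial_deriv i p = (\<Sum>m\<in>M. Poly_Mapping.single (m - Poly_Mapping.single i 1)
           (of_nat (Poly_Mapping.lookup m i) * Poly_Mapping.lookup p m))"
  unfolding partial_deriv_def using assms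
  by (intro sum.mono_neutral_left) (auto simp: in_keys_iff)

lemma partial_deriv_add: "partial_deriv i (p + q) = partial_deriv i p + partial_deriv i q"
proof -
  let ?M = "Poly_Mapping.keys p \<union> Poly_Mapping.keys q"
  have "Poly_Mapping.keys (p + q) \<subseteq> ?M" by (rule keys_add)
  then show ?thesis
    by (simp add: partial_deriv_superset[of ?M] lookup_add algebra_simps single_add sum.distrib)
qed

lemma partial_deriv_single:
  "partial_deriv i (Poly_Mapping.single m c)
     = Poly_Mapping.single (m - Poly_Mapping.single i 1) (of_nat (Poly_Mapping.lookup m i) * c)"
  by (subst partial_deriv_superset[of "{m}"]) (auto split: if_splits)

lemma partial_deriv_const [simp]: "partial_deriv i (const c) = 0"
  by (simp add: const_def partial_deriv_single)

lemma partial_deriv_var: "partial_deriv i (var j) = (if i = j then 1 else 0)"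
  by (auto simp: var_def partial_deriv_single lookup_single)

lemma partial_deriv_var_mult:
  "partial_deriv i (var j * Poly_Mapping.single m c)
     = (if i = j then Poly_Mapping.single m c else 0) + var j * partial_deriv i (Poly_Mapping.single m c)"
proof -
  let ?e = "\<lambda>i. Poly_Mapping.single i (1::nat)"
  have shift: "?e j + (m - ?e i) = (?e j + m) - ?e i" if "i \<noteq> j \<or> Poly_Mapping.lookup m i \<noteq> 0"
    using that by (intro poly_mapping_eqI)
      (auto simp: lookup_add lookup_minus lookup_single when_def)
  show ?thesis
  proof (cases "Poly_Mapping.lookup m i = 0")
    case True
    then show ?thesis
      by (auto simp: var_def mult_single partial_deriv_single lookup_add lookup_single)
  next
    case False
    then show ?thesis
      using shift by (auto simp: var_def mult_single partial_deriv_single lookup_add lookup_single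
          algebra_simps single_add)
  qed
qed

text \<open>
  The chain rule. It shows that a derivation is determined by its values on the variables, and
  expresses derivations that vanish on all variables but one through a single partial derivative.
\<close>

lemma k_derivation_eq_sum_partial_deriv:
  fixes E :: "('n::finite, 'k::field) mpoly \<Rightarrow> ('n, 'k) mpoly"
  assumes E: "k_derivation E"
  shows "E p = (\<Sum>i\<in>UNIV. E (var i) * partial_deriv i p)"
proof (induction p rule: mpoly_induct)
  case (var_mult j m c)
  let ?p = "Poly_Mapping.single m c"
  have "(\<Sum>i\<in>UNIV. E (var i) * partial_deriv i (var j * ?p))
      = (\<Sum>i\<in>UNIV. (if i = j then E (var i) * ?p else 0) + var j * (E (var i) * partial_deriv i ?p))"
    by (intro sum.cong) (auto simp: partial_deriv_var_mult algebra_simps)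
  also have "\<dots> = E (var j) * ?p + var j * E ?p"
    by (simp add: sum.distrib var_mult flip: sum_distrib_left)
  finally show ?case by (simp add: k_derivation_mult[OF E])
qed (simp_all add: k_derivation_add[OF E] k_derivation_const[OF E] partial_deriv_add algebra_simps sum.distrib)

lemma k_derivation_eq_diagonal:
  assumes "k_derivation E" "\<And>i. E (var i) = const (l i) * var i"
  shows "E = diagonal_derivation l"
  using k_derivation_eq_sum_partial_deriv[OF assms(1)]
  by (simp add: fun_eq_iff diagonal_derivation_def assms(2))

lemma diagonal_derivation_var: "diagonal_derivation l (var i) = const (l i) * var i"
  by (simp add: diagonal_derivation_def partial_deriv_var if_distrib cong: if_cong)

text \<open>
  In characteristic zero the monomials containing \<open>x\<^sub>j\<close> are sent to nonzero multiples of pairwise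
  different monomials.
\<close>

lemma partial_deriv_eq_0_iff:
  fixes p :: "('n, 'k::field_char_0) mpoly"
  shows "partial_deriv j p = 0 \<longleftrightarrow> p \<in> polys_in (- {j})"
proof
  assume "p \<in> polys_in (- {j})"
  then have "Poly_Mapping.lookup m j = 0" if "m \<in> Poly_Mapping.keys p" for m
    using that by (auto simp: polys_in_def in_keys_iff)
  then show "partial_deriv j p = 0"
    by (simp add: partial_deriv_def)
next
  assume p: "partial_deriv j p = 0"
  have "Poly_Mapping.lookup m j = 0" if m: "m \<in> Poly_Mapping.keys p" for m
  proof (rule ccontr)
    let ?e = "Poly_Mapping.single j (1::nat)"
    assume mj: "Poly_Mapping.lookup m j \<noteq> 0"
    (* Truncated subtraction of the unit vector is injective on exponents that are positive at j. *)
    have inj: "m' = m" if "m' - ?e = m - ?e" "Poly_Mapping.lookup m' j \<noteq> 0" for m'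
    proof (rule poly_mapping_eqI)
      fix i
      have "Poly_Mapping.lookup (m' - ?e) i = Poly_Mapping.lookup (m - ?e) i" using that by simp
      then show "Poly_Mapping.lookup m' i = Poly_Mapping.lookup m i"
        using that mj by (cases "i = j") (auto simp: lookup_minus lookup_single)
    qed
    have "0 = Poly_Mapping.lookup (partial_deriv j p) (m - ?e)" using p by simp
    also have "\<dots> = (\<Sum>m'\<in>Poly_Mapping.keys p. if m' = m then of_nat (Poly_Mapping.lookup m j) * Poly_Mapping.lookup p m else 0)"
      unfolding partial_deriv_def lookup_sum
      using inj mj by (intro sum.cong) (auto simp: lookup_single when_def)
    also have "\<dots> = of_nat (Poly_Mapping.lookup m j) * Poly_Mapping.lookup p m"
      using m by simp
    finally show False using m mj by (simp add: in_keys_iff)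
  qed
  then show "p \<in> polys_in (- {j})"
    by (auto simp: polys_in_def in_keys_iff)
qed

lemma der_ker_eq_polys_in:
  fixes E :: "('n::{finite,linorder}, 'k::field_char_0) mpoly \<Rightarrow> ('n, 'k) mpoly"
  assumes E: "k_derivation E" and "\<And>i. i \<noteq> j \<Longrightarrow> E (var i) = 0" and "E (var j) \<noteq> 0"
  shows "der_ker E = polys_in (- {j})"
proof -
  have E_eq: "E p = E (var j) * partial_deriv j p" for p
  proof -
    have "E p = (\<Sum>i\<in>UNIV. E (var i) * partial_deriv i p)"
      by (rule k_derivation_eq_sum_partial_deriv[OF E])
    also have "\<dots> = (\<Sum>i\<in>UNIV. if i = j then E (var j) * partial_deriv j p else 0)"
      using assms(2) by (intro sum.cong) auto
    finally show ?thesis by simp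
  qed
  have "E p = 0 \<longleftrightarrow> partial_deriv j p = 0" for p
    unfolding E_eq[of p] using assms(3) by simp
  then show ?thesis
    by (simp add: set_eq_iff der_ker_def partial_deriv_eq_0_iff)
qed

section \<open>Automorphisms\<close>

lemma k_automorphism_comp:
  "k_automorphism \<psi> \<Longrightarrow> k_automorphism \<phi> \<Longrightarrow> k_automorphism (\<psi> \<circ> \<phi>)"
  unfolding k_automorphism_def by (simp add: bij_comp)

lemma k_automorphism_simps:
  assumes "k_automorphism \<phi>"
  shows "\<phi> (p + q) = \<phi> p + \<phi> q" "\<phi> (p * q) = \<phi> p * \<phi> q" "\<phi> (const c) = const c"
    and "\<phi> 0 = 0" "\<phi> 1 = 1" "\<phi> (inv \<phi> p) = p" "inv \<phi> (\<phi> p) = p"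
proof -
  show const: "\<phi> (const c) = const c" for c
    using assms by (simp add: k_automorphism_def)
  show "\<phi> 0 = 0" "\<phi> 1 = 1"
    using const[of 0] const[of 1] by simp_all
qed (use assms in \<open>auto simp: k_automorphism_def bij_is_inj bij_is_surj surj_f_inv_f\<close>)

lemma k_automorphism_inv:
  assumes "k_automorphism \<phi>"
  shows "k_automorphism (inv \<phi>)"
proof -
  note simps = k_automorphism_simps[OF assms]
  have "inv \<phi> (p + q) = inv \<phi> p + inv \<phi> q" for p q
    using simps(7)[of "inv \<phi> p + inv \<phi> q"] by (simp add: simps)
  moreover have "inv \<phi> (p * q) = inv \<phi> p * inv \<phi> q" for p q
    using simps(7)[of "inv \<phi> p * inv \<phi> q"] by (simp add: simps)
  moreover have "inv \<phi> (const c) = const c" for c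
    using simps(7)[of "const c"] by (simp add: simps)
  ultimately show ?thesis
    using assms by (simp add: k_automorphism_def bij_imp_bij_inv)
qed

lemma k_derivation_conjugate:
  assumes "k_automorphism \<phi>" "k_derivation D"
  shows "k_derivation (\<phi> \<circ> D \<circ> inv \<phi>)"
  unfolding k_derivation_def
  by (simp add: k_automorphism_simps[OF assms(1)] k_automorphism_simps(1-3)[OF k_automorphism_inv[OF assms(1)]]
      k_derivation_add[OF assms(2)] k_derivation_mult[OF assms(2)] k_derivation_const[OF assms(2)])

lemma der_ker_conjugate:
  assumes "k_automorphism \<phi>"
  shows "der_ker (\<phi> \<circ> D \<circ> inv \<phi>) = \<phi> ` der_ker D"
proof -
  note simps = k_automorphism_simps[OF assms]
  have eq_0: "\<phi> x = 0 \<longleftrightarrow> x = 0" for x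
    using simps(7)[of x] simps(7)[of 0] by (metis simps(4))
  have "x \<in> \<phi> ` der_ker D \<longleftrightarrow> inv \<phi> x \<in> der_ker D" for x
    by (metis image_iff simps(6,7))
  then show ?thesis
    by (simp add: set_eq_iff der_ker_def eq_0)
qed

definition subst :: "('n::finite \<Rightarrow> ('n, 'k::field) mpoly) \<Rightarrow> ('n, 'k) mpoly \<Rightarrow> ('n, 'k) mpoly" where
  "subst g p = (\<Sum>m\<in>Poly_Mapping.keys p. const (Poly_Mapping.lookup p m) * (\<Prod>i\<in>UNIV. g i ^ Poly_Mapping.lookup m i))"

lemma subst_superset:
  assumes "finite M" "Poly_Mapping.keys p \<subseteq> M"
  shows "subst g p = (\<Sum>m\<in>M. const (Poly_Mapping.lookup p m) * (\<Prod>i\<in>UNIV. g i ^ Poly_Mapping.lookup m i))"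
  unfolding subst_def using assms
  by (intro sum.mono_neutral_left) (auto simp: in_keys_iff)

lemma subst_add: "subst g (p + q) = subst g p + subst g q"
proof -
  let ?M = "Poly_Mapping.keys p \<union> Poly_Mapping.keys q"
  have "Poly_Mapping.keys (p + q) \<subseteq> ?M" by (rule keys_add)
  then show ?thesis
    by (simp add: subst_superset[of ?M] lookup_add const_add algebra_simps sum.distrib)
qed

lemma subst_single: "subst g (Poly_Mapping.single m c) = const c * (\<Prod>i\<in>UNIV. g i ^ Poly_Mapping.lookup m i)"
  by (subst subst_superset[of "{m}"]) (auto split: if_splits)

lemma subst_0 [simp]: "subst g 0 = 0"
  by (simp add: subst_def)

lemma subst_const [simp]: "subst g (const c) = const c"
  using subst_single[of g 0 c] by (simp add: const_def)

lemma subst_var [simp]: "subst g (var i) = g i"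
proof -
  have "(\<Prod>j\<in>UNIV. g j ^ Poly_Mapping.lookup (Poly_Mapping.single i 1) j) = (\<Prod>j\<in>UNIV. if j = i then g i else 1)"
    by (intro prod.cong) (auto simp: lookup_single)
  then show ?thesis by (simp add: var_def subst_single)
qed

lemma subst_mult: "subst g (p * q) = subst g p * subst g q"
proof (induction p rule: mpoly_additive_induct)
  case (single m c)
  show ?case
    by (induction q rule: mpoly_additive_induct)
      (simp_all add: algebra_simps subst_add mult_single subst_single const_mult lookup_add power_add prod.distrib)
qed (simp_all add: algebra_simps subst_add)

lemma subst_comp_eq_id:
  assumes "\<And>i. subst g (h i) = var i"
  shows "subst g (subst h p) = p"
  by (induction p rule: mpoly_induct) (simp_all add: subst_add subst_mult assms)

text \<open>
  Automorphisms are given by the images of the variables; it suffices to check on the variables that two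
  substitutions are inverse to each other.
\<close>

lemma k_automorphism_subst:
  assumes "\<And>i. subst g (h i) = var i" "\<And>i. subst h (g i) = var i"
  shows "k_automorphism (subst g)" and "inv (subst g) = subst h"
proof -
  have 1: "subst g \<circ> subst h = id" and 2: "subst h \<circ> subst g = id"
    using subst_comp_eq_id assms by (auto simp: fun_eq_iff)
  show "k_automorphism (subst g)"
    using o_bij[OF 2 1] by (simp add: k_automorphism_def subst_add subst_mult)
  show "inv (subst g) = subst h"
    using inv_unique_comp[OF 1 2] .
qed

lemma subst_var_id: "subst var p = p"
  by (induction p rule: mpoly_induct) (simp_all add: subst_add subst_mult)

lemma subst_polys_in_id:
  assumes p: "p \<in> polys_in V" and g: "\<And>i. i \<in> V \<Longrightarrow> g i = var i"
  shows "subst g p = p"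
proof -
  have "g i ^ Poly_Mapping.lookup m i = var i ^ Poly_Mapping.lookup m i"
    if "m \<in> Poly_Mapping.keys p" for m i
  proof (cases "i \<in> Poly_Mapping.keys m")
    case True
    then have "i \<in> V" using p that by (auto simp: polys_in_def)
    then show ?thesis by (simp add: g)
  next
    case False
    then show ?thesis by (simp add: in_keys_iff)
  qed
  then have "subst g p = subst var p"
    unfolding subst_def by (intro sum.cong prod.cong arg_cong2[where f = "(*)"]) auto
  then show ?thesis by (simp add: subst_var_id)
qed

section \<open>The slice theorem\<close>

lemma set_coeffs_subset_der_ker_iff:
  assumes "k_derivation D"
  shows "set (coeffs P) \<subseteq> der_ker D \<longleftrightarrow> (\<forall>n. D (coeff P n) = 0)"
proof -
  have "set (coeffs P) \<subseteq> der_ker D \<longleftrightarrow> range (coeff P) \<subseteq> der_ker D"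
    unfolding range_coeff by (simp add: der_ker_def k_derivation_zero[OF assms])
  then show ?thesis by (auto simp: der_ker_def)
qed

lemma k_derivation_poly:
  fixes D :: "('n::linorder, 'k::field) mpoly \<Rightarrow> ('n, 'k) mpoly"
  assumes D: "k_derivation D" and "\<forall>n. D (coeff P n) = 0"
  shows "D (poly P s) = poly (pderiv P) s * D s"
  using assms(2)
proof (induction P)
  case (pCons a P)
  have "D a = 0" using pCons.prems[rule_format, of 0] by simp
  moreover have "\<forall>n. D (coeff P n) = 0" using pCons.prems by (metis coeff_pCons_Suc)
  ultimately show ?case
    using pCons.IH by (simp add: k_derivation_add[OF D] k_derivation_mult[OF D] pderiv_pCons algebra_simps)
qed (simp add: k_derivation_zero[OF D])

text \<open>
  If \<open>P(s) = 0\<close>, applying \<open>D\<close> gives \<open>P'(s) = 0\<close>; by induction on the degree \<open>P' = 0\<close>, so \<open>P\<close> is a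
  constant, and this constant is \<open>P(s) = 0\<close>.
\<close>

lemma slice_expansion_unique:
  fixes D :: "('n::linorder, 'k::field_char_0) mpoly \<Rightarrow> ('n, 'k) mpoly"
  assumes D: "k_derivation D" and s: "D s = 1"
  assumes "\<forall>n. D (coeff P n) = 0" "poly P s = 0"
  shows "P = 0"
  using assms(3,4)
proof (induction "degree P" arbitrary: P rule: less_induct)
  case less
  have "pderiv P = 0"
  proof (cases "degree P = 0")
    case False
    have "degree (pderiv P) < degree P"
      using False by (simp add: degree_pderiv)
    moreover have "\<forall>n. D (coeff (pderiv P) n) = 0"
      using less.prems(1)
      by (simp add: coeff_pderiv k_derivation_const_mult[OF D] del: of_nat_Suc flip: const_of_nat)
    moreover have "poly (pderiv P) s = 0"
      using k_derivation_poly[OF D less.prems(1), of s] less.prems(2) s by (simp add: k_derivation_zero[OF D])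
    ultimately show ?thesis using less.hyps by blast
  qed (simp add: pderiv_eq_0_iff)
  then obtain a where "P = [:a:]" using pderiv_iszero by blast
  then show ?case using less.prems(2) by simp
qed

lemma antiderivative_poly:
  fixes D :: "('n::linorder, 'k::field_char_0) mpoly \<Rightarrow> ('n, 'k) mpoly"
  assumes D: "k_derivation D" and P: "\<forall>n. D (coeff P n) = 0"
  obtains Q where "\<forall>n. D (coeff Q n) = 0" "pderiv Q = P"
proof
  define Q where "Q = (\<Sum>j\<le>degree P. monom (const (inverse (of_nat (Suc j))) * coeff P j) (Suc j))"
  have Suc: "coeff Q (Suc n) = const (inverse (of_nat (Suc n))) * coeff P n" for n
    by (simp add: Q_def coeff_sum coeff_eq_0 del: of_nat_Suc)
  have 0: "coeff Q 0 = 0"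
    by (simp add: Q_def coeff_sum)
  show "\<forall>n. D (coeff Q n) = 0"
  proof
    fix n show "D (coeff Q n) = 0"
      using P 0 Suc by (cases n) (simp_all add: k_derivation_const_mult[OF D] k_derivation_zero[OF D])
  qed
  show "pderiv Q = P"
  proof (rule poly_eqI)
    fix n
    have "of_nat (Suc n) * const (inverse (of_nat (Suc n))) = (1 :: ('n, 'k) mpoly)"
      by (simp del: of_nat_Suc flip: const_of_nat const_mult)
    then show "coeff (pderiv Q) n = coeff P n"
      by (simp add: coeff_pderiv Suc mult.assoc [symmetric] del: of_nat_Suc)
  qed
qed

text \<open>
  By induction on the order of nilpotency \<open>D b = P(s)\<close>. With an antiderivative \<open>Q\<close> of \<open>P\<close> the element
  \<open>b - Q(s)\<close> is killed by \<open>D\<close> and can be added to the constant coefficient of \<open>Q\<close>.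
\<close>

lemma slice_expansion_exists:
  fixes D :: "('n::linorder, 'k::field_char_0) mpoly \<Rightarrow> ('n, 'k) mpoly"
  assumes D: "k_derivation D" and s: "D s = 1" and "(D ^^ m) b = 0"
  shows "\<exists>P. (\<forall>n. D (coeff P n) = 0) \<and> poly P s = b"
  using assms(3)
proof (induction m arbitrary: b)
  case 0
  then show ?case by (intro exI[of _ 0]) (simp add: k_derivation_zero[OF D])
next
  case (Suc m)
  then have "(D ^^ m) (D b) = 0" by (simp add: funpow_swap1)
  with Suc.IH obtain P where P: "\<forall>n. D (coeff P n) = 0" "poly P s = D b" by blast
  obtain Q where Q: "\<forall>n. D (coeff Q n) = 0" "pderiv Q = P"
    using antiderivative_poly[OF D P(1)] .
  let ?R = "Q + [:b - poly Q s:]"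
  have "D (b - poly Q s) = 0"
    using k_derivation_poly[OF D Q(1), of s] Q(2) P(2) s by (simp add: k_derivation_diff[OF D])
  then have "D (coeff ?R n) = 0" for n
    using Q(1) by (cases n) (simp_all add: k_derivation_add[OF D])
  then show ?case by (intro exI[of _ ?R]) simp
qed

section \<open>The derivation associated with the slice action\<close>

lemma laurent_polynomial_eq_0:
  fixes d :: "int \<Rightarrow> 'k::field"
  assumes inf: "infinite (UNIV :: 'k set)" and M: "finite M"
    and zero: "\<And>t. t \<noteq> 0 \<Longrightarrow> (\<Sum>m\<in>M. t powi m * d m) = 0" and m: "m \<in> M"
  shows "d m = 0"
proof -
  (* Multiplication by a power of t turns the Laurent polynomial into a polynomial Q that vanishes at
     all nonzero points. *)
  define K where "K = Min M"
  have K: "K \<le> m" if "m \<in> M" for m using M that by (simp add: K_def)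
  define Q where "Q = (\<Sum>m\<in>M. monom (d m) (nat (m - K)))"
  have "poly Q t = 0" if t: "t \<noteq> 0" for t
  proof -
    have "t powi m = t powi K * t ^ nat (m - K)" if "m \<in> M" for m
      using K[OF that] t by (simp add: power_int_add [symmetric] flip: power_int_of_nat)
    then have "t powi K * poly Q t = (\<Sum>m\<in>M. t powi m * d m)"
      by (simp add: Q_def poly_sum poly_monom sum_distrib_left mult_ac)
    then show ?thesis using zero[OF t] t by simp
  qed
  then have "UNIV - {0} \<subseteq> {t. poly Q t = 0}" by auto
  moreover have "infinite (UNIV - {0 :: 'k})" using inf by simp
  ultimately have "Q = 0" using poly_roots_finite infinite_super by blast
  moreover have "coeff Q (nat (m - K)) = (\<Sum>m'\<in>M. if m' = m then d m else 0)"
    unfolding Q_def coeff_sum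
  proof (intro sum.cong refl)
    fix m' assume "m' \<in> M"
    then have "nat (m' - K) = nat (m - K) \<longleftrightarrow> m' = m" using K[of m'] K[OF m] by auto
    then show "coeff (monom (d m') (nat (m' - K))) (nat (m - K)) = (if m' = m then d m else 0)"
      by simp
  qed
  ultimately show ?thesis using M m by simp
qed

text \<open>
  The exponent sets of two expansions of the same function may differ, so the comparison is made on
  their union. It makes the derivation associated with an action unique.
\<close>

lemma laurent_expansion_unique:
  fixes c c' :: "int \<Rightarrow> ('n, 'k::field_char_0) mpoly"
  assumes M: "finite M" "finite M'"
    and eq: "\<And>t. t \<noteq> 0 \<Longrightarrow> (\<Sum>m\<in>M. const (t powi m) * c m) = (\<Sum>m\<in>M'. const (t powi m) * c' m)"
  shows "(\<Sum>m\<in>M. of_int m * c m) = (\<Sum>m\<in>M'. of_int m * c' m)"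
proof -
  define d where "d m = (if m \<in> M then c m else 0) - (if m \<in> M' then c' m else 0)" for m
  have sum_d: "(\<Sum>m\<in>M \<union> M'. f m * d m) = (\<Sum>m\<in>M. f m * c m) - (\<Sum>m\<in>M'. f m * c' m)" for f
  proof -
    have "(\<Sum>m\<in>M \<union> M'. f m * (if m \<in> M then c m else 0)) = (\<Sum>m\<in>M. f m * c m)"
      using M by (intro sum.mono_neutral_cong_right) auto
    moreover have "(\<Sum>m\<in>M \<union> M'. f m * (if m \<in> M' then c' m else 0)) = (\<Sum>m\<in>M'. f m * c' m)"
      using M by (intro sum.mono_neutral_cong_right) auto
    ultimately show ?thesis
      by (simp only: d_def right_diff_distrib sum_subtractf)
  qed
  have "d m = 0" if "m \<in> M \<union> M'" for m
  proof (rule poly_mapping_eqI)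
    fix x
    have "(\<Sum>m\<in>M \<union> M'. t powi m * Poly_Mapping.lookup (d m) x) = 0" if "t \<noteq> 0" for t
    proof -
      have "(\<Sum>m\<in>M \<union> M'. const (t powi m) * d m) = 0"
        unfolding sum_d using eq[OF that] by simp
      then have "Poly_Mapping.lookup (\<Sum>m\<in>M \<union> M'. const (t powi m) * d m) x = 0" by simp
      then show ?thesis by (simp add: lookup_sum lookup_const_mult)
    qed
    then show "Poly_Mapping.lookup (d m) x = Poly_Mapping.lookup 0 x"
      using laurent_polynomial_eq_0[of "M \<union> M'" "\<lambda>m. Poly_Mapping.lookup (d m) x" m] M \<open>m \<in> M \<union> M'\<close>
      by (simp add: infinite_UNIV_char_0)
  qed
  then have "(\<Sum>m\<in>M \<union> M'. of_int m * d m) = 0" by simp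
  then show ?thesis unfolding sum_d by simp
qed

text \<open>
  The coefficients \<open>a\<^sub>j s\<^sup>j\<close> of \<open>b = P(s)\<close> are the weight components of \<open>b\<close>, of weight \<open>N j\<close>; the formula
  for \<open>D b\<close> rests on \<open>s D(s\<^sup>j) = j s\<^sup>j\<close>.
\<close>

lemma slice_action_expansion:
  fixes D :: "('n::{finite,linorder}, 'k::field_char_0) mpoly \<Rightarrow> ('n, 'k) mpoly"
  assumes D: "k_derivation D" "locally_nilpotent D" and s: "D s = 1" and N: "N \<noteq> 0"
  shows "\<exists>M c. finite M \<and>
    (\<forall>t. t \<noteq> 0 \<longrightarrow> slice_action D s N t b = (\<Sum>m\<in>M. const (t powi m) * c m)) \<and>
    of_int N * s * D b = (\<Sum>m\<in>M. of_int m * c m)"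
proof -
  obtain m where "(D ^^ m) b = 0" using D(2) by (auto simp: locally_nilpotent_def)
  then obtain P where P: "\<forall>n. D (coeff P n) = 0" "poly P s = b"
    using slice_expansion_exists[OF D(1) s] by blast
  have uniq: "P' = P" if "set (coeffs P') \<subseteq> der_ker D" "poly P' s = b" for P'
  proof -
    have "P' - P = 0"
      using that P
      by (intro slice_expansion_unique[OF D(1) s])
        (auto simp: set_coeffs_subset_der_ker_iff[OF D(1)] k_derivation_diff[OF D(1)])
    then show ?thesis by simp
  qed
  have "set (coeffs P) \<subseteq> der_ker D"
    unfolding set_coeffs_subset_der_ker_iff[OF D(1)] by (fact P(1))
  then have the: "(THE P. set (coeffs P) \<subseteq> der_ker D \<and> poly P s = b) = P"
    using P(2) uniq by (intro the_equality conjI) blast+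
  define e where "e j = N * int j" for j
  define M where "M = e ` {..degree P}"
  define c where "c m = coeff P (nat (m div N)) * s ^ nat (m div N)" for m
  have c: "c (e j) = coeff P j * s ^ j" for j
    using N by (simp add: c_def e_def)
  have inj: "inj_on e {..degree P}"
    using N by (auto simp: inj_on_def e_def)
  show ?thesis
  proof (intro exI conjI allI impI)
    show "finite M" by (simp add: M_def)
    fix t :: 'k assume "t \<noteq> 0"
    show "slice_action D s N t b = (\<Sum>m\<in>M. const (t powi m) * c m)"
    proof -
      have "(const (t powi e j) :: ('n, 'k) mpoly) = const (t powi N) ^ j" for j
        by (simp add: e_def power_int_mult const_power)
      then have "(\<Sum>m\<in>M. const (t powi m) * c m)
          = (\<Sum>j\<le>degree P. const (t powi N) ^ j * (coeff P j * s ^ j))"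
        unfolding M_def sum.reindex[OF inj] o_def by (simp only: c)
      also have "\<dots> = poly P (const (t powi N) * s)"
        unfolding poly_altdef by (simp only: power_mult_distrib mult.left_commute)
      finally show ?thesis
        unfolding slice_action_def the Let_def ..
    qed
  next
    have pow: "s * D (s ^ j) = of_nat j * s ^ j" for j
      using k_derivation_const[OF D(1), of 1]
      by (induction j) (simp_all add: k_derivation_mult[OF D(1)] s algebra_simps)
    have "s * D b = (\<Sum>j\<le>degree P. coeff P j * (s * D (s ^ j)))"
      unfolding P(2)[symmetric] poly_altdef k_derivation_sum[OF D(1)] sum_distrib_left
      using P(1) by (simp add: k_derivation_mult[OF D(1)] mult.left_commute)
    then have "of_int N * (s * D b) = of_int N * (\<Sum>j\<le>degree P. coeff P j * (s * D (s ^ j)))"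
      by (rule arg_cong)
    also have "\<dots> = (\<Sum>j\<le>degree P. of_int (e j) * c (e j))"
      unfolding pow c sum_distrib_left by (simp add: e_def mult_ac)
    finally show "of_int N * s * D b = (\<Sum>m\<in>M. of_int m * c m)"
      unfolding M_def sum.reindex[OF inj] o_def by (simp only: mult.assoc)
  qed
qed

lemma associated_derivation_slice_action_iff:
  fixes D :: "('n::{finite,linorder}, 'k::field_char_0) mpoly \<Rightarrow> ('n, 'k) mpoly"
  assumes D: "k_derivation D" "locally_nilpotent D" and s: "D s = 1" and N: "N \<noteq> 0"
  shows "associated_derivation (slice_action D s N) \<Delta> \<longleftrightarrow> \<Delta> = (\<lambda>b. of_int N * s * D b)"
proof
  assume \<Delta>: "associated_derivation (slice_action D s N) \<Delta>"
  show "\<Delta> = (\<lambda>b. of_int N * s * D b)"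
  proof
    fix b
    obtain M c where M: "finite M"
      and c: "\<forall>t. t \<noteq> 0 \<longrightarrow> slice_action D s N t b = (\<Sum>m\<in>M. const (t powi m) * c m)"
      and \<Delta>b: "\<Delta> b = (\<Sum>m\<in>M. of_int m * c m)"
      using \<Delta> unfolding associated_derivation_def by blast
    obtain M' c' where M': "finite M'"
      and c': "\<forall>t. t \<noteq> 0 \<longrightarrow> slice_action D s N t b = (\<Sum>m\<in>M'. const (t powi m) * c' m)"
      and Db: "of_int N * s * D b = (\<Sum>m\<in>M'. of_int m * c' m)"
      using slice_action_expansion[OF assms, of b] by blast
    have "(\<Sum>m\<in>M. const (t powi m) * c m) = (\<Sum>m\<in>M'. const (t powi m) * c' m)" if "t \<noteq> 0" for t
      using c c' that by simp
    then show "\<Delta> b = of_int N * s * D b"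
      unfolding \<Delta>b Db by (rule laurent_expansion_unique[OF M M'])
  qed
next
  assume "\<Delta> = (\<lambda>b. of_int N * s * D b)"
  moreover have "k_derivation (\<lambda>b. of_int N * s * D b)"
    using k_derivation_scale[OF D(1)] .
  ultimately show "associated_derivation (slice_action D s N) \<Delta>"
    unfolding associated_derivation_def using slice_action_expansion[OF assms] by blast
qed

section \<open>Linearizability\<close>

lemma less_last_index: "{i. i < last_index} = - {last_index :: 'n::{finite,linorder}}"
proof -
  have "i \<le> last_index" for i :: 'n by (simp add: last_index_def)
  then show ?thesis by (auto simp: less_le)
qed

lemma var_in_polys_in: "i \<in> V \<Longrightarrow> var i \<in> polys_in V"
  by (simp add: polys_in_def var_def)

text \<open>
  The core of the implication from linearizability: the slice divides \<open>\<lambda>\<^sub>i x\<^sub>i\<close> for every \<open>i\<close>, and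
  polynomial rings have few divisors of variables.
\<close>

lemma slice_eq_scaled_variable:
  fixes E :: "('n::{finite,linorder}, 'k::field_char_0) mpoly \<Rightarrow> ('n, 'k) mpoly"
  assumes E: "k_derivation E" and \<sigma>: "E \<sigma> = 1"
    and diag: "\<And>i. \<sigma> * E (var i) = const (l i) * var i"
  obtains j c where "c \<noteq> 0" "\<sigma> = const c * var j" "\<And>i. i \<noteq> j \<Longrightarrow> E (var i) = 0"
proof -
  have "\<sigma> \<noteq> 0" using \<sigma> k_derivation_zero[OF E] by auto
  have "\<exists>j. l j \<noteq> 0"
  proof (rule ccontr)
    assume "\<not> ?thesis"
    then have "E (var i) = 0" for i using diag[of i] \<open>\<sigma> \<noteq> 0\<close> by simp
    then show False
      using k_derivation_eq_sum_partial_deriv[OF E, of \<sigma>] \<sigma> by simp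
  qed
  then obtain j where j: "l j \<noteq> 0" by blast
  have "\<sigma> \<noteq> const c" for c using \<sigma> k_derivation_const[OF E] by auto
  then obtain d where d: "E (var j) = const d"
    using divisors_of_var[OF diag j] by blast
  have "d \<noteq> 0" using d diag[of j] j by auto
  define c where "c = l j / d"
  have "\<sigma> = const (inverse d) * (\<sigma> * const d)"
    using const_cancel(2)[OF \<open>d \<noteq> 0\<close>, of \<sigma>] by (simp only: mult_ac)
  also have "\<dots> = const c * var j"
    unfolding diag[of j, unfolded d] c_def divide_inverse const_mult by (simp only: mult_ac)
  finally have \<sigma>_eq: "\<sigma> = const c * var j" .
  show ?thesis
  proof
    show "c \<noteq> 0" using j \<open>d \<noteq> 0\<close> by (simp add: c_def)
    show "\<sigma> = const c * var j" by (fact \<sigma>_eq)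
    fix i assume "i \<noteq> j"
    (* Setting the j-th variable to zero kills the left side of diag but not the i-th variable. *)
    let ?g = "\<lambda>i. if i = j then 0 else var i"
    have "subst ?g (\<sigma> * E (var i)) = 0"
      by (simp add: \<sigma>_eq subst_mult)
    then have "l i = 0"
      using \<open>i \<noteq> j\<close> unfolding diag by (simp add: subst_mult)
    then show "E (var i) = 0" using diag[of i] \<open>\<sigma> \<noteq> 0\<close> by simp
  qed
qed

lemma slice_straightening:
  fixes D :: "('n::{finite,linorder}, 'k::field_char_0) mpoly \<Rightarrow> ('n, 'k) mpoly"
  assumes D: "k_derivation D" and s: "D s = 1" and N: "N \<noteq> 0"
    and \<phi>: "k_automorphism \<phi>"
    and diag: "\<phi> \<circ> (\<lambda>b. of_int N * s * D b) \<circ> inv \<phi> = diagonal_derivation l"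
  obtains \<psi> where "k_automorphism \<psi>" "\<psi> ` der_ker D = polys_in (- {last_index})" "\<psi> s = var last_index"
proof -
  define E where "E = \<phi> \<circ> D \<circ> inv \<phi>"
  have E: "k_derivation E" unfolding E_def using k_derivation_conjugate[OF \<phi> D] .
  note \<phi>_simps = k_automorphism_simps[OF \<phi>]
  have \<sigma>: "E (\<phi> s) = 1" by (simp add: E_def \<phi>_simps s)
  have "\<And>i. \<phi> s * E (var i) = const (l i / of_int N) * var i"
  proof -
    fix i
    have "const (of_int N) * (\<phi> s * E (var i)) = const (l i) * var i"
      using fun_cong[OF diag, of "var i"]
      by (simp add: diagonal_derivation_var E_def \<phi>_simps mult.assoc flip: const_of_int)
    then have "\<phi> s * E (var i) = const (inverse (of_int N)) * (const (l i) * var i)"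
      using const_cancel(2)[of "of_int N" "\<phi> s * E (var i)"] N by simp
    then show "\<phi> s * E (var i) = const (l i / of_int N) * var i"
      by (simp only: divide_inverse const_mult mult_ac)
  qed
  then obtain j c where c: "c \<noteq> 0" and \<phi>s: "\<phi> s = const c * var j" and Ei: "\<And>i. i \<noteq> j \<Longrightarrow> E (var i) = 0"
    by (rule slice_eq_scaled_variable[OF E \<sigma>]) blast
  (* g exchanges the j-th and the last variable and scales so that c times the j-th variable becomes
     the last one; h is its inverse. *)
  define \<tau> where "\<tau> = id(j := last_index, last_index := j :: 'n)"
  define g :: "'n \<Rightarrow> ('n, 'k) mpoly" where "g i = const (if i = j then inverse c else 1) * var (\<tau> i)" for i
  define h :: "'n \<Rightarrow> ('n, 'k) mpoly" where "h i = const (if i = last_index then c else 1) * var (\<tau> i)" for i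
  have gh: "subst g (h i) = var i" "subst h (g i) = var i" for i
    using c by (auto simp: g_def h_def \<tau>_def subst_mult const_cancel)
  note aut = k_automorphism_subst[OF gh]
  define \<psi> where "\<psi> = subst g \<circ> \<phi>"
  have \<psi>: "k_automorphism \<psi>" unfolding \<psi>_def using k_automorphism_comp[OF aut(1) \<phi>] .
  define F where "F = subst g \<circ> E \<circ> inv (subst g)"
  have F: "k_derivation F" unfolding F_def using k_derivation_conjugate[OF aut(1) E] .
  have s': "\<psi> s = var last_index"
    using c by (simp add: \<psi>_def \<phi>s subst_mult g_def \<tau>_def const_cancel)
  have "F (\<psi> s) = 1"
    using subst_const[of g 1] by (simp add: F_def \<psi>_def k_automorphism_simps(7)[OF aut(1)] \<sigma>)
  then have "F (var last_index) \<noteq> 0" by (simp add: s')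
  moreover have "F (var i) = 0" if "i \<noteq> last_index" for i
  proof -
    have "\<tau> i \<noteq> j" using that by (auto simp: \<tau>_def split: if_splits)
    then show ?thesis using that by (simp add: F_def aut h_def Ei)
  qed
  ultimately have "der_ker F = polys_in (- {last_index})"
    using der_ker_eq_polys_in[OF F] by blast
  moreover have "der_ker F = \<psi> ` der_ker D"
    unfolding F_def der_ker_conjugate[OF aut(1)] E_def der_ker_conjugate[OF \<phi>] \<psi>_def
    by (rule image_comp)
  ultimately show ?thesis using that \<psi> s' by simp
qed

lemma diagonal_of_straightened_slice:
  fixes D :: "('n::{finite,linorder}, 'k::field_char_0) mpoly \<Rightarrow> ('n, 'k) mpoly"
  assumes D: "k_derivation D" and s: "D s = 1"
    and \<phi>: "k_automorphism \<phi>" and ker: "\<phi> ` der_ker D = polys_in (- {last_index})"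
    and f: "f \<in> polys_in (- {last_index})" and \<phi>s: "\<phi> s = var last_index + f"
  obtains \<psi> where "k_automorphism \<psi>"
    and "\<psi> \<circ> (\<lambda>b. of_int N * s * D b) \<circ> inv \<psi> = diagonal_derivation (\<lambda>i. if i = last_index then of_int N else 0)"
proof -
  (* The substitutions g and h are inverse triangular automorphisms, since f does not involve the last
     variable and is fixed by both. *)
  define g where "g i = (if i = last_index then var i - f else var i)" for i
  define h where "h i = (if i = last_index then var i + f else var i)" for i
  have subst_fixed: "subst g p = p" "subst h p = p" if "p \<in> polys_in (- {last_index})" for p
    using that by (rule subst_polys_in_id; simp add: g_def h_def)+
  have "subst h (var i - f) = h i - f" for i
    using subst_add[of h "var i - f" f] subst_fixed(2)[OF f] by (simp add: algebra_simps)
  then have gh: "subst g (h i) = var i" "subst h (g i) = var i" for i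
    by (auto simp: g_def h_def subst_add subst_fixed[OF f])
  note aut = k_automorphism_subst[OF gh]
  define \<psi> where "\<psi> = subst g \<circ> \<phi>"
  have \<psi>: "k_automorphism \<psi>" unfolding \<psi>_def using k_automorphism_comp[OF aut(1) \<phi>] .
  note \<psi>_simps = k_automorphism_simps[OF \<psi>]
  have \<psi>s: "\<psi> s = var last_index"
    by (simp add: \<psi>_def \<phi>s subst_add g_def subst_fixed[OF f])
  define E where "E = \<psi> \<circ> D \<circ> inv \<psi>"
  have "der_ker E = subst g ` polys_in (- {last_index})"
    unfolding E_def der_ker_conjugate[OF \<psi>] ker[symmetric] by (simp only: \<psi>_def image_comp)
  then have kerE: "der_ker E = polys_in (- {last_index})"
    by (simp add: subst_fixed)
  have E_last: "E (var last_index) = 1"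
    by (simp add: E_def s \<psi>_simps flip: \<psi>s)
  have E_other: "E (var i) = 0" if "i \<noteq> last_index" for i
    using kerE var_in_polys_in[of i "- {last_index}"] that by (auto simp: der_ker_def)
  let ?L = "\<psi> \<circ> (\<lambda>b. of_int N * s * D b) \<circ> inv \<psi>"
  have "?L p = const (of_int N) * var last_index * E p" for p
    by (simp add: \<psi>_simps \<psi>s E_def flip: const_of_int)
  then have "?L (var i) = const (if i = last_index then of_int N else 0) * var i" for i
    using E_last E_other by simp
  then have "?L = diagonal_derivation (\<lambda>i. if i = last_index then of_int N else 0)"
    by (intro k_derivation_eq_diagonal k_derivation_conjugate[OF \<psi>] k_derivation_scale[OF D])
  then show ?thesis by (rule that[OF \<psi>])
qed

theorem corollary6p2:
  fixes D :: "('n::{finite,linorder}, 'k::{alg_closed_field,field_char_0}) mpoly \<Rightarrow> ('n, 'k) mpoly"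
    and s :: "('n, 'k) mpoly"
    and N :: int
  assumes "k_derivation D"
    and "locally_nilpotent D"
    and "D s = 1"
    and "N \<noteq> 0"
  shows "linearizable (slice_action D s N) \<longleftrightarrow>
    (\<exists>\<phi>. k_automorphism \<phi> \<and>
       \<phi> ` der_ker D = polys_in {i. i < last_index} \<and>
       (\<exists>f \<in> polys_in {i. i < last_index}. \<phi> s = var last_index + f))"
    (is "_ \<longleftrightarrow> ?straight")
proof -
  let ?\<Delta> = "\<lambda>b. of_int N * s * D b"
  have lin: "linearizable (slice_action D s N) \<longleftrightarrow>
      (\<exists>\<phi> l. k_automorphism \<phi> \<and> \<phi> \<circ> ?\<Delta> \<circ> inv \<phi> = diagonal_derivation l)"
    by (simp add: linearizable_def associated_derivation_slice_action_iff[OF assms])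
  show ?thesis
  proof
    assume "linearizable (slice_action D s N)"
    then obtain \<phi> l where "k_automorphism \<phi>" "\<phi> \<circ> ?\<Delta> \<circ> inv \<phi> = diagonal_derivation l"
      unfolding lin by blast
    then obtain \<psi> where \<psi>: "k_automorphism \<psi>" "\<psi> ` der_ker D = polys_in (- {last_index})"
      and \<psi>s: "\<psi> s = var last_index"
      by (rule slice_straightening[OF assms(1,3,4)])
    have "\<psi> s = var last_index + 0" by (simp add: \<psi>s)
    moreover have "0 \<in> polys_in (- {last_index})" by (simp add: polys_in_def)
    ultimately show ?straight unfolding less_last_index using \<psi> by blast
  next
    assume ?straight
    then obtain \<phi> f where "k_automorphism \<phi>" "\<phi> ` der_ker D = polys_in (- {last_index})"
      "f \<in> polys_in (- {last_index})" "\<phi> s = var last_index + f"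
      unfolding less_last_index by blast
    then obtain \<psi> where "k_automorphism \<psi>"
      "\<psi> \<circ> ?\<Delta> \<circ> inv \<psi> = diagonal_derivation (\<lambda>i. if i = last_index then of_int N else 0)"
      by (rule diagonal_of_straightened_slice[OF assms(1,3)])
    then show "linearizable (slice_action D s N)"
      unfolding lin by blast
  qed
qed

end
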